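(* Let $E$ be a finite-dimensional vector space over $\mathbb{R}$, and let $E_+ \subseteq E$ be a generating polyhedral cone which is not a simplex cone. Let $\varphi_1,\ldots,\varphi_m \in E_+^*$ be representatives of the extremal rays of $E_+^*$ (one for each extremal ray). Let $F := \mathbb{R}^m$ with the standard cone $F_+ := \mathbb{R}_{\geq 0}^m$, and identify $E$ with a subspace of $F$ via the bipositive linear map $T : E \to F$, $x \mapsto (\varphi_1(x),\ldots,\varphi_m(x))$. Then the identity $\mathrm{id}_E : E \to E$ cannot be approximated by positive operators $E \to E$ that can be extended to positive operators $F \to E$; that is, $\mathrm{id}_E$ does not belong to the closure, in the finite-dimensional space of linear maps $E \to E$ with its usual topology, of the set of positive linear maps $E \to E$ that have an extension to a positive linear map $F \to E$.
   Context: All vector spaces are over $\mathbb{R}$. A wedge in a vector space is a non-empty subset closed under addition and under multiplication by non-negative scalars; a cone is a wedge $\mathcal{K}$ with $\mathcal{K} \cap (-\mathcal{K}) = \{0\}$. The cone $E_+$ is generating if $E_+ - E_+ = E$, and polyhedral if it is a finite intersection of closed half-spaces of the form $\{x \in E : \langle x, \varphi\rangle \geq 0\}$ with $\varphi \in E^*$. A wedge $\mathcal{K} \subseteq E$ is a simplex cone (or Yudin cone) if there is an algebraic basis $\mathcal{B}$ of $E$ such that $\mathcal{K}$ is the wedge generated by $\mathcal{B}$. $E^*$ is the algebraic dual of $E$, and $E_+^* := \{\varphi \in E^* : \langle x,\varphi\rangle \geq 0 \text{ for all } x \in E_+\}$ is the dual wedge, i.e. the set of positive linear functionals on $E$. A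 linear map (operator) between spaces with positive cones is positive if it maps the positive cone into the positive cone; a linear map $T : E \to F$ is bipositive if for all $x \in E$ one has $x \in E_+$ if and only if $T(x) \in F_+$. Under the identification of $E$ with $T(E) \subseteq F$, a linear map $S : F \to E$ extends a linear map $A : E \to E$ if $S \circ T = A$. *)

theory Defs
  imports "HOL-Analysis.Analysis"
begin

text \<open>
  Wedges are the library's \<^const>\<open>convex_cone\<close>: by \<open>convex_cone_iff\<close> these are the sets containing
  \<open>0\<close> (equivalently, non-empty) that are closed under addition and under multiplication by
  non-negative scalars. The wedge generated by a set \<open>B\<close> is \<open>convex_cone hull B\<close>.
\<close>

definition pointed_cone :: "'a::real_vector set \<Rightarrow> bool" where
  "pointed_cone K \<longleftrightarrow> convex_cone K \<and> K \<inter> uminus ` K = {0}"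

definition generating_cone :: "'a::real_vector set \<Rightarrow> bool" where
  "generating_cone K \<longleftrightarrow> {x - y | x y. x \<in> K \<and> y \<in> K} = UNIV"

definition polyhedral_cone :: "'a::real_vector set \<Rightarrow> bool" where
  "polyhedral_cone K \<longleftrightarrow>
     (\<exists>H :: ('a \<Rightarrow> real) set. finite H \<and> (\<forall>\<phi>\<in>H. linear \<phi>) \<and> K = (\<Inter>\<phi>\<in>H. {x. \<phi> x \<ge> 0}))"

definition simplex_cone :: "'a::real_vector set \<Rightarrow> bool" where
  "simplex_cone K \<longleftrightarrow> (\<exists>B. independent B \<and> span B = UNIV \<and> K = convex_cone hull B)"

text \<open>
  Elements of the algebraic dual are linear functions \<^typ>\<open>'a \<Rightarrow> real\<close>. As functions carry no
  \<^class>\<open>real_vector\<close> structure here, the operations on functionals are written pointwise.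
\<close>

definition dual_wedge :: "'a::real_vector set \<Rightarrow> ('a \<Rightarrow> real) set" where
  "dual_wedge K = {\<phi>. linear \<phi> \<and> (\<forall>x\<in>K. \<phi> x \<ge> 0)}"

definition functional_ray :: "('a \<Rightarrow> real) \<Rightarrow> ('a \<Rightarrow> real) set" where
  "functional_ray \<phi> = {\<lambda>x. c * \<phi> x | c. c \<ge> 0}"

text \<open>
  A non-zero \<open>\<phi>\<close> in a wedge \<open>W\<close> of functionals spans an extremal ray if \<open>\<phi> = \<psi> + \<theta>\<close> with
  \<open>\<psi>, \<theta> \<in> W\<close> is only possible for \<open>\<psi>\<close> and \<open>\<theta>\<close> that are non-negative multiples of \<open>\<phi>\<close>.
\<close>

definition extremal_rays :: "('a \<Rightarrow> real) set \<Rightarrow> ('a \<Rightarrow> real) set set" where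
  "extremal_rays W =
     {functional_ray \<phi> | \<phi>. \<phi> \<in> W \<and> \<phi> \<noteq> (\<lambda>x. 0) \<and>
        (\<forall>\<psi>\<in>W. \<forall>\<theta>\<in>W. \<phi> = (\<lambda>x. \<psi> x + \<theta> x) \<longrightarrow> \<psi> \<in> functional_ray \<phi> \<and> \<theta> \<in> functional_ray \<phi>)}"

definition positive_operator ::
    "'a::real_vector set \<Rightarrow> 'b::real_vector set \<Rightarrow> ('a \<Rightarrow> 'b) \<Rightarrow> bool" where
  "positive_operator K L A \<longleftrightarrow> linear A \<and> A ` K \<subseteq> L"

definition bipositive ::
    "'a::real_vector set \<Rightarrow> 'b::real_vector set \<Rightarrow> ('a \<Rightarrow> 'b) \<Rightarrow> bool" where
  "bipositive K L A \<longleftrightarrow> linear A \<and> (\<forall>x. x \<in> K \<longleftrightarrow> A x \<in> L)"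

definition standard_cone :: "(real ^ 'm) set" where
  "standard_cone = {v. \<forall>i. v $ i \<ge> 0}"

definition evaluation_map :: "('m \<Rightarrow> 'a \<Rightarrow> real) \<Rightarrow> 'a \<Rightarrow> real ^ 'm" where
  "evaluation_map \<phi> x = (\<chi> i. \<phi> i x)"

text \<open>
  The positive operators on \<open>E\<close> that extend along \<open>T : E \<rightarrow> F\<close> to a positive operator \<open>F \<rightarrow> E\<close>, where
  \<open>K\<close> and \<open>L\<close> are the cones of \<open>E\<close> and \<open>F\<close>. On a finite-dimensional normed space every linear
  map is bounded, so there the type \<open>'a \<Rightarrow>\<^sub>L 'a\<close> consists of all linear maps, and its operator norm
  topology is the usual one, whatever the norm on \<open>'a\<close>.
\<close>

definition extendable_positive_operators ::
    "'a::real_normed_vector set \<Rightarrow> 'b::real_vector set \<Rightarrow> ('a \<Rightarrow> 'b) \<Rightarrow> ('a \<Rightarrow>\<^sub>L 'a) set" where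
  "extendable_positive_operators K L T =
     {A. positive_operator K K (blinfun_apply A) \<and>
         (\<exists>S. positive_operator L K S \<and> S \<circ> T = blinfun_apply A)}"

end

theory Submission
  imports Defs
begin

text \<open>
  If \<open>A\<^sub>k \<rightarrow> id\<close> and \<open>S\<^sub>k\<close> is a positive extension of \<open>A\<^sub>k\<close>, then \<open>M\<^sub>k = T \<circ> S\<^sub>k\<close> is an entrywise
  non-negative matrix with \<open>M\<^sub>k (T x) \<rightarrow> T x\<close> for all \<open>x\<close>. By Farkas' lemma and extremality there is,
  for \<open>i \<noteq> j\<close>, a point \<open>x\<close> of the cone with \<open>\<phi>\<^sub>j x = 0\<close> and \<open>\<phi>\<^sub>i x > 0\<close>; this forces the \<open>(j, i)\<close>
  entry of \<open>M\<^sub>k\<close> to tend to \<open>0\<close>, and then the diagonal entries tend to \<open>1\<close>. So the standard basis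
  vectors are limits of points in the range of \<open>T\<close>, which is closed; thus \<open>T\<close> is an isomorphism
  of \<open>E\<close> onto \<open>F\<close>, and the cone is a simplex cone.
\<close>

section \<open>Farkas' lemma for finitely many functionals\<close>

text \<open>Induction on \<open>I\<close>. If the functionals other than \<open>f n\<close> already
  force \<psi> to be non-negative, \<open>f n\<close> gets coefficient 0. Otherwise some point
  \<open>z\<close> violates this implication, \<open>f n\<close> must be negative there, and the
  induction hypothesis is applied to the functionals restricted to the kernel of
  \<open>f n\<close>.\<close>

lemma farkas:
  fixes f :: "'i \<Rightarrow> 'a::real_vector \<Rightarrow> real"
  assumes "finite I" "\<And>i. i \<in> I \<Longrightarrow> linear (f i)" "linear \<psi>"
    and "\<And>x. (\<And>i. i \<in> I \<Longrightarrow> f i x \<ge> 0) \<Longrightarrow> \<psi> x \<ge> 0"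
  shows "\<exists>c. (\<forall>i\<in>I. c i \<ge> 0) \<and> (\<forall>x. \<psi> x = (\<Sum>i\<in>I. c i * f i x))"
  using assms
proof (induction I arbitrary: f \<psi> rule: finite_induct)
  case empty
  have "\<psi> x = 0" for x
    using empty(3)[of x] empty(3)[of "- x"] linear_neg[OF empty(2), of x] by simp
  then show ?case by simp
next
  case (insert n I)
  have lf: "linear (f n)" "\<And>i. i \<in> I \<Longrightarrow> linear (f i)"
    using insert.prems(1) by auto
  show ?case
  proof (cases "\<forall>x. (\<forall>i\<in>I. f i x \<ge> 0) \<longrightarrow> \<psi> x \<ge> 0")
    case True
    then obtain c where c: "\<forall>i\<in>I. c i \<ge> 0" "\<forall>x. \<psi> x = (\<Sum>i\<in>I. c i * f i x)"
      using insert.IH[of f \<psi>] lf(2) insert.prems(2) by blast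
    have "(\<Sum>i\<in>I. (c(n := 0)) i * f i x) = (\<Sum>i\<in>I. c i * f i x)" for x
      using insert.hyps(2) by (intro sum.cong) auto
    with c insert.hyps show ?thesis
      by (intro exI[of _ "c(n := 0)"]) simp
  next
    case False
    then obtain z where z: "\<And>i. i \<in> I \<Longrightarrow> f i z \<ge> 0" "\<psi> z < 0" by force
    then have neg: "f n z < 0"
      using insert.prems(3)[of z] by force
    \<comment> \<open>The scaling gives \<open>f n w = - 1\<close>, which makes the map
      \<open>p\<close> below the projection onto the kernel of \<open>f n\<close> along
      \<open>w\<close>.\<close>
    define r where "r = inverse (- f n z)"
    define w where "w = r *\<^sub>R z"
    have r: "r > 0" "r * f n z = - 1" using neg by (simp_all add: r_def)
    have w: "f n w = - 1" "\<And>i. i \<in> I \<Longrightarrow> f i w \<ge> 0" "\<psi> w < 0"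
      using z r lf insert.prems(2) by (auto simp: w_def linear_cmul mult_pos_neg)
    \<comment> \<open>Restrict to the hyperplane \<open>f n = 0\<close> by projecting along \<open>w\<close>.\<close>
    define p where "p x = x + f n x *\<^sub>R w" for x
    have p: "linear p"
      unfolding p_def using lf(1)
      by (intro linearI) (auto simp: linear_add linear_cmul algebra_simps)
    have fp: "g (p x) = g x + g w * f n x" if "linear g" for g :: "'a \<Rightarrow> real" and x
      using that by (simp add: p_def linear_add linear_cmul)
    have fnp: "f n (p x) = 0" for x
      using fp[OF lf(1)] w(1) by simp
    have "\<exists>c. (\<forall>i\<in>I. c i \<ge> 0) \<and> (\<forall>x. (\<psi> \<circ> p) x = (\<Sum>i\<in>I. c i * (f i \<circ> p) x))"
    proof (rule insert.IH)
      show "linear (f i \<circ> p)" if "i \<in> I" for i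
        using that lf p by (intro linear_compose) auto
      show "linear (\<psi> \<circ> p)"
        using insert.prems(2) p by (intro linear_compose) auto
      show "(\<psi> \<circ> p) x \<ge> 0" if "\<And>i. i \<in> I \<Longrightarrow> (f i \<circ> p) x \<ge> 0" for x
        using insert.prems(3)[of "p x"] that fnp by force
    qed
    then obtain c where c: "\<forall>i\<in>I. c i \<ge> 0" "\<And>x. \<psi> (p x) = (\<Sum>i\<in>I. c i * f i (p x))"
      by auto
    \<comment> \<open>Expanding both sides of \<open>c(2)\<close> with \<open>fp\<close> and
      collecting the multiples of \<open>f n x\<close> leaves exactly this coefficient; its sign
      comes from \<open>\<psi> w < 0\<close>.\<close>
    define d where "d = (\<Sum>i\<in>I. c i * f i w) - \<psi> w"
    have "(\<Sum>i\<in>I. c i * f i w) \<ge> 0"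
      using c(1) w(2) by (intro sum_nonneg) auto
    then have d: "d \<ge> 0" using w(3) by (simp add: d_def)
    have "\<psi> x = d * f n x + (\<Sum>i\<in>I. c i * f i x)" for x
    proof -
      have "(\<Sum>i\<in>I. c i * f i (p x)) = (\<Sum>i\<in>I. c i * f i x + c i * f i w * f n x)"
        using lf(2) by (intro sum.cong) (auto simp: fp algebra_simps)
      also have "\<dots> = (\<Sum>i\<in>I. c i * f i x) + (\<Sum>i\<in>I. c i * f i w) * f n x"
        by (simp add: sum.distrib sum_distrib_right)
      finally show ?thesis
        using c(2)[of x] fp[OF insert.prems(2), of x] by (simp add: d_def algebra_simps)
    qed
    moreover have "(\<Sum>i\<in>I. (c(n := d)) i * f i x) = (\<Sum>i\<in>I. c i * f i x)" for x
      using insert.hyps(2) by (intro sum.cong) auto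
    ultimately show ?thesis
      using c(1) d insert.hyps by (intro exI[of _ "c(n := d)"]) simp
  qed
qed

section \<open>Dual wedges and extremal rays\<close>

lemma dual_wedge_scale: "\<phi> \<in> dual_wedge K \<Longrightarrow> c \<ge> 0 \<Longrightarrow> (\<lambda>x. c * \<phi> x) \<in> dual_wedge K"
  by (auto simp: dual_wedge_def linear_iff algebra_simps)

lemma dual_wedge_add:
  "\<phi> \<in> dual_wedge K \<Longrightarrow> \<psi> \<in> dual_wedge K \<Longrightarrow> (\<lambda>x. \<phi> x + \<psi> x) \<in> dual_wedge K"
  by (auto simp: dual_wedge_def linear_iff algebra_simps)

lemma dual_wedge_sum:
  assumes "finite I" "\<And>i. i \<in> I \<Longrightarrow> f i \<in> dual_wedge K" "\<And>i. i \<in> I \<Longrightarrow> c i \<ge> 0"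
  shows "(\<lambda>x. \<Sum>i\<in>I. c i * f i x) \<in> dual_wedge K"
  using assms
proof (induction I rule: finite_induct)
  case empty
  then show ?case by (simp add: dual_wedge_def linear_iff)
next
  case (insert i I)
  then show ?case by (auto intro!: dual_wedge_add dual_wedge_scale)
qed

lemma functional_ray_self: "\<phi> \<in> functional_ray \<phi>"
  by (auto simp: functional_ray_def intro!: exI[of _ 1])

lemma generating_cone_zero_functional:
  assumes "generating_cone K" "linear f" "\<And>x. x \<in> K \<Longrightarrow> f x = 0"
  shows "f = (\<lambda>x. 0)"
proof
  fix z
  have "z \<in> {x - y | x y. x \<in> K \<and> y \<in> K}"
    using assms(1) by (simp add: generating_cone_def)
  then obtain x y where "z = x - y" "x \<in> K" "y \<in> K" by auto
  then show "f z = 0" using assms by (simp add: linear_diff)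
qed

text \<open>Two non-negative numbers with sum 0 vanish, so \<psi> is zero on \<open>K\<close> and
  hence on \<open>K - K\<close>, the whole space. In other words, the dual wedge of a generating
  cone is pointed.\<close>

lemma generating_cone_dual_pointed:
  assumes "generating_cone K" "\<psi> \<in> dual_wedge K" "\<theta> \<in> dual_wedge K" "\<And>x. \<psi> x + \<theta> x = 0"
  shows "\<psi> = (\<lambda>x. 0)"
proof (rule generating_cone_zero_functional[OF assms(1)])
  show "linear \<psi>" using assms(2) by (simp add: dual_wedge_def)
  show "\<psi> x = 0" if "x \<in> K" for x
    using assms(2,3) that assms(4)[of x] by (force simp: dual_wedge_def)
qed

text \<open>\<open>extremal_rays\<close> asserts extremality for some generator of the ray only; as
  two generators differ by a positive factor, it passes to any given one.\<close>

lemma extremal_raysD: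
  assumes "functional_ray \<phi> \<in> extremal_rays (dual_wedge K)"
  shows "\<phi> \<in> dual_wedge K" "\<phi> \<noteq> (\<lambda>x. 0)"
    and "\<lbrakk>\<psi> \<in> dual_wedge K; \<theta> \<in> dual_wedge K; \<And>x. \<phi> x = \<psi> x + \<theta> x\<rbrakk> \<Longrightarrow> \<psi> \<in> functional_ray \<phi>"
proof -
  obtain \<rho> where \<rho>: "functional_ray \<phi> = functional_ray \<rho>" "\<rho> \<in> dual_wedge K" "\<rho> \<noteq> (\<lambda>x. 0)"
    "\<And>\<psi> \<theta>. \<psi> \<in> dual_wedge K \<Longrightarrow> \<theta> \<in> dual_wedge K \<Longrightarrow> \<rho> = (\<lambda>x. \<psi> x + \<theta> x) \<Longrightarrow> \<psi> \<in> functional_ray \<rho>"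
    using assms unfolding extremal_rays_def by blast
  have "\<phi> \<in> functional_ray \<rho>" using \<rho>(1) functional_ray_self by metis
  then obtain c where c: "c \<ge> 0" "\<phi> = (\<lambda>x. c * \<rho> x)" by (auto simp: functional_ray_def)
  have "\<rho> \<in> functional_ray \<phi>" using \<rho>(1) functional_ray_self by metis
  then show ne: "\<phi> \<noteq> (\<lambda>x. 0)" using \<rho>(3) by (auto simp: functional_ray_def)
  then have c0: "c > 0" using c by (cases "c = 0") auto
  show "\<phi> \<in> dual_wedge K" using c \<rho>(2) dual_wedge_scale by blast
  assume *: "\<psi> \<in> dual_wedge K" "\<theta> \<in> dual_wedge K" "\<And>x. \<phi> x = \<psi> x + \<theta> x"
  \<comment> \<open>Dividing by \<open>c\<close> turns the decomposition of \<phi> into one of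
    \<rho>, to which extremality applies.\<close>
  have "(\<lambda>x. inverse c * \<psi> x) \<in> functional_ray \<rho>"
  proof (rule \<rho>(4))
    show "(\<lambda>x. inverse c * \<psi> x) \<in> dual_wedge K" "(\<lambda>x. inverse c * \<theta> x) \<in> dual_wedge K"
      using * c0 by (auto intro!: dual_wedge_scale)
    have "inverse c * \<psi> x + inverse c * \<theta> x = \<rho> x" for x
      using *(3)[of x] c c0 by (simp add: field_simps)
    then show "\<rho> = (\<lambda>x. inverse c * \<psi> x + inverse c * \<theta> x)" by simp
  qed
  then obtain d where d: "d \<ge> 0" "(\<lambda>x. inverse c * \<psi> x) = (\<lambda>x. d * \<phi> x)"
    unfolding \<rho>(1)[symmetric] by (auto simp: functional_ray_def)
  have "\<psi> x = (c * d) * \<phi> x" for x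
    using fun_cong[OF d(2), of x] c0 by (simp add: field_simps)
  then show "\<psi> \<in> functional_ray \<phi>"
    using c(1) d(1) by (auto simp: functional_ray_def intro!: exI[of _ "c * d"])
qed

lemma functional_ray_eqI:
  assumes "\<psi> \<in> functional_ray \<phi>" "\<psi> \<noteq> (\<lambda>x. 0)"
  shows "functional_ray \<psi> = functional_ray \<phi>"
proof -
  obtain c where c: "c \<ge> 0" "\<psi> = (\<lambda>x. c * \<phi> x)"
    using assms(1) by (auto simp: functional_ray_def)
  with assms(2) have c0: "c > 0" by (cases "c = 0") auto
  show ?thesis
  proof (intro set_eqI iffI)
    fix \<theta> assume "\<theta> \<in> functional_ray \<psi>"
    then obtain d where "d \<ge> 0" "\<theta> = (\<lambda>x. (d * c) * \<phi> x)"
      using c by (auto simp: functional_ray_def mult.assoc)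
    then show "\<theta> \<in> functional_ray \<phi>"
      unfolding functional_ray_def using c(1) by fastforce
  next
    fix \<theta> assume "\<theta> \<in> functional_ray \<phi>"
    then obtain d where "d \<ge> 0" "\<theta> = (\<lambda>x. (d / c) * \<psi> x)"
      using c c0 by (auto simp: functional_ray_def)
    then show "\<theta> \<in> functional_ray \<psi>"
      unfolding functional_ray_def using c0 by fastforce
  qed
qed

section \<open>Polyhedral cones as intersections of extremal half-spaces\<close>

lemma polyhedral_cone_halfspaces_in_dual:
  fixes K :: "'a::real_vector set"
  assumes "polyhedral_cone K"
  obtains H where "finite H" "H \<subseteq> dual_wedge K" "K = (\<Inter>\<phi>\<in>H. {x. \<phi> x \<ge> 0})"
proof -
  from assms obtain H :: "('a \<Rightarrow> real) set" where H: "finite H" "\<forall>\<phi>\<in>H. linear \<phi>"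
    "K = (\<Inter>\<phi>\<in>H. {x. \<phi> x \<ge> 0})"
    unfolding polyhedral_cone_def by blast
  have "H \<subseteq> dual_wedge K"
    unfolding dual_wedge_def H(3) using H(2) by blast
  with H show thesis using that by blast
qed

text \<open>Used for bipositivity of the evaluation map: membership in \<open>K\<close> can be
  tested on representatives of the extremal rays.\<close>

lemma polyhedral_cone_extremal_halfspaces:
  assumes gen: "generating_cone K" and poly: "polyhedral_cone K"
  obtains H where "K = (\<Inter>\<phi>\<in>H. {x. \<phi> x \<ge> 0})" "H \<subseteq> dual_wedge K"
    "\<And>h. h \<in> H \<Longrightarrow> functional_ray h \<in> extremal_rays (dual_wedge K)"
proof -
  \<comment> \<open>A defining family of least cardinality consists of extremal functionals.\<close>
  define P where "P H \<longleftrightarrow> finite H \<and> H \<subseteq> dual_wedge K \<and> K = (\<Inter>\<phi>\<in>H. {x. \<phi> x \<ge> 0})" for H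
  obtain H0 where "P H0"
    using polyhedral_cone_halfspaces_in_dual[OF poly] unfolding P_def by metis
  then obtain H where PH: "P H" and min: "\<And>H'. P H' \<Longrightarrow> card H \<le> card H'"
    using ex_has_least_nat[of P H0 card] by blast
  have fin: "finite H" and sub: "H \<subseteq> dual_wedge K" and KH: "K = (\<Inter>\<phi>\<in>H. {x. \<phi> x \<ge> 0})"
    using PH unfolding P_def by blast+
  have "functional_ray h \<in> extremal_rays (dual_wedge K)" if h: "h \<in> H" for h
  proof -
    \<comment> \<open>Otherwise \<open>h\<close> could be dropped from \<open>H\<close>, against
      minimality.\<close>
    have irredundant: False
      if c: "\<And>g. g \<in> H - {h} \<Longrightarrow> c g \<ge> 0" and eq: "\<And>x. h x = (\<Sum>g\<in>H - {h}. c g * g x)" for c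
    proof -
      have "h x \<ge> 0" if "\<And>g. g \<in> H - {h} \<Longrightarrow> g x \<ge> 0" for x
      proof -
        have "(\<Sum>g\<in>H - {h}. c g * g x) \<ge> 0" using that c by (intro sum_nonneg) auto
        then show ?thesis using eq[of x] by linarith
      qed
      then have "K = (\<Inter>\<phi>\<in>H - {h}. {x. \<phi> x \<ge> 0})"
        unfolding KH by blast
      then have "P (H - {h})" using fin sub unfolding P_def by blast
      from min[OF this] show False using fin h by (metis card_Diff1_less not_le)
    qed
    have rep: "\<exists>c. (\<forall>g\<in>H. c g \<ge> 0) \<and> (\<forall>x. \<psi> x = (\<Sum>g\<in>H. c g * g x))"
      if "\<psi> \<in> dual_wedge K" for \<psi>
    proof (rule farkas[OF fin])
      show "linear g" if "g \<in> H" for g using that sub by (auto simp: dual_wedge_def)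
      show "linear \<psi>" using that by (simp add: dual_wedge_def)
      show "\<psi> x \<ge> 0" if "\<And>g. g \<in> H \<Longrightarrow> g x \<ge> 0" for x
      proof -
        have "x \<in> K" unfolding KH using that by simp
        then show ?thesis using \<open>\<psi> \<in> dual_wedge K\<close> by (simp add: dual_wedge_def)
      qed
    qed
    have "h \<noteq> (\<lambda>x. 0)"
      using irredundant[of "\<lambda>_. 0"] by auto
    moreover have part: "\<psi> \<in> functional_ray h"
      if \<psi>: "\<psi> \<in> dual_wedge K" and \<theta>: "\<theta> \<in> dual_wedge K" and eq: "h = (\<lambda>x. \<psi> x + \<theta> x)" for \<psi> \<theta>
    proof -
      obtain a where a: "\<forall>g\<in>H. a g \<ge> 0" "\<forall>x. \<psi> x = (\<Sum>g\<in>H. a g * g x)"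
        using rep[OF \<psi>] by auto
      obtain b where b: "\<forall>g\<in>H. b g \<ge> 0" "\<forall>x. \<theta> x = (\<Sum>g\<in>H. b g * g x)"
        using rep[OF \<theta>] by auto
      let ?r = "\<lambda>x. \<Sum>g\<in>H - {h}. a g * g x" and ?s = "\<lambda>x. \<Sum>g\<in>H - {h}. b g * g x"
      have \<psi>x: "\<psi> x = a h * h x + ?r x" and \<theta>x: "\<theta> x = b h * h x + ?s x" for x
        using a(2) b(2) h fin by (simp_all add: sum.remove)
      have hx: "h x = (a h + b h) * h x + (?r x + ?s x)" for x
        using fun_cong[OF eq, of x] \<psi>x[of x] \<theta>x[of x] by (simp add: algebra_simps)
      have r: "?r \<in> dual_wedge K" and s: "?s \<in> dual_wedge K"
        using a(1) b(1) fin sub by (auto intro!: dual_wedge_sum)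
      \<comment> \<open>If the sum were below 1, solving \<open>hx\<close> for \<open>h\<close>
        would write it as a non-negative combination of the other members of
        \<open>H\<close>.\<close>
      have ab: "a h + b h \<ge> 1"
      proof (rule ccontr)
        assume "\<not> a h + b h \<ge> 1"
        then have pos: "1 - (a h + b h) > 0" by simp
        have "h x = (\<Sum>g\<in>H - {h}. ((a g + b g) / (1 - (a h + b h))) * g x)" for x
        proof -
          have "(1 - (a h + b h)) * h x = (\<Sum>g\<in>H - {h}. (a g + b g) * g x)"
            using hx[of x] by (simp add: sum.distrib algebra_simps)
          then have "h x = (\<Sum>g\<in>H - {h}. (a g + b g) * g x) / (1 - (a h + b h))"
            using pos by (simp add: field_simps)
          then show ?thesis by (simp add: sum_divide_distrib)
        qed
        then show False
          using irredundant[of "\<lambda>g. (a g + b g) / (1 - (a h + b h))"] a(1) b(1) pos by auto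
      qed
      \<comment> \<open>By \<open>ab\<close>, \<open>hx\<close> now reads as a vanishing sum of
        elements of the dual wedge, so pointedness removes \<open>?r\<close> and leaves \<psi> as a
        multiple of \<open>h\<close>.\<close>
      have "?r = (\<lambda>x. 0)"
      proof (rule generating_cone_dual_pointed[OF gen r])
        show "(\<lambda>x. ?s x + (a h + b h - 1) * h x) \<in> dual_wedge K"
          using s ab sub h by (intro dual_wedge_add dual_wedge_scale) auto
        show "?r x + (?s x + (a h + b h - 1) * h x) = 0" for x
          using hx[of x] by (simp add: algebra_simps)
      qed
      then have "\<psi> x = a h * h x" for x
        using \<psi>x[of x] by (metis add.right_neutral)
      then have "\<psi> = (\<lambda>x. a h * h x)" by (rule ext)
      then show ?thesis using a(1) h by (auto simp: functional_ray_def)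
    qed
    moreover have "\<theta> \<in> functional_ray h"
      if "\<psi> \<in> dual_wedge K" "\<theta> \<in> dual_wedge K" "h = (\<lambda>x. \<psi> x + \<theta> x)" for \<psi> \<theta>
      using part[OF that(2,1)] that(3) by (simp add: add.commute)
    ultimately show ?thesis
      unfolding extremal_rays_def using h sub by blast
  qed
  with KH sub that show thesis by blast
qed

text \<open>If \<open>g\<close> were non-positive on the face of \<open>K\<close> where
  \<open>f\<close> vanishes, Farkas' lemma for \<open>H\<close> together with \<open>- f\<close>
  would give \<open>d * f = g + s\<close> with \<open>s\<close> in the dual wedge. Extremality of
  \<open>f\<close> would then put \<open>g\<close> on the ray of \<open>f\<close>.\<close>

lemma extremal_functionals_separated:
  assumes gen: "generating_cone K" and poly: "polyhedral_cone K"
    and f: "functional_ray f \<in> extremal_rays (dual_wedge K)"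
    and g: "functional_ray g \<in> extremal_rays (dual_wedge K)"
    and ne: "functional_ray f \<noteq> functional_ray g"
  obtains x where "x \<in> K" "f x = 0" "g x > 0"
proof -
  obtain H where fin: "finite H" and sub: "H \<subseteq> dual_wedge K" and KH: "K = (\<Inter>\<phi>\<in>H. {x. \<phi> x \<ge> 0})"
    using polyhedral_cone_halfspaces_in_dual[OF poly] .
  note fD = extremal_raysD[OF f] and gD = extremal_raysD[OF g]
  have lin: "linear f" "linear g" using fD(1) gD(1) by (auto simp: dual_wedge_def)
  have neg: "linear (\<lambda>x. - k x)" if "linear k" for k :: "'a \<Rightarrow> real"
    using that by (simp add: linear_iff)
  have "\<exists>x\<in>K. f x = 0 \<and> g x > 0"
  proof (rule ccontr)
    assume no: "\<not> ?thesis"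
    define I where "I = insert (\<lambda>x. - f x) H"
    have "\<exists>c. (\<forall>h\<in>I. c h \<ge> 0) \<and> (\<forall>x. - g x = (\<Sum>h\<in>I. c h * h x))"
    proof (rule farkas)
      show "finite I" using fin by (simp add: I_def)
      show "linear h" if "h \<in> I" for h
        using that sub lin(1) neg by (auto simp: I_def dual_wedge_def)
      show "linear (\<lambda>x. - g x)" using lin(2) neg by auto
      show "- g x \<ge> 0" if x: "\<And>h. h \<in> I \<Longrightarrow> h x \<ge> 0" for x
      proof -
        have "x \<in> K" unfolding KH using x by (auto simp: I_def)
        moreover from this have "f x \<ge> 0" using fD(1) by (auto simp: dual_wedge_def)
        moreover have "f x \<le> 0" using x[of "\<lambda>x. - f x"] by (simp add: I_def)
        ultimately show ?thesis using no by force
      qed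
    qed
    then obtain c where c: "\<forall>h\<in>I. c h \<ge> 0" "\<forall>x. - g x = (\<Sum>h\<in>I. c h * h x)" by blast
    define d where "d = c (\<lambda>x. - f x)"
    \<comment> \<open>Taking \<open>- f\<close> out of \<open>H\<close> keeps its coefficient from
      being counted twice, whether or not it lies in \<open>H\<close>.\<close>
    let ?J = "H - {\<lambda>x. - f x}"
    define s where "s = (\<lambda>x. \<Sum>h\<in>?J. c h * h x)"
    have d: "d \<ge> 0" using c(1) by (simp add: d_def I_def)
    have s: "s \<in> dual_wedge K"
      unfolding s_def using fin sub c(1) by (intro dual_wedge_sum) (auto simp: I_def)
    have eq: "d * f x = g x + s x" for x
      using c(2)[rule_format, of x] fin
      by (simp add: I_def sum.insert_remove d_def s_def)
    \<comment> \<open>With \<open>d = 0\<close> the functionals \<open>g\<close> and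
      \<open>s\<close> would cancel, and pointedness would make \<open>g\<close> zero.\<close>
    have "d \<noteq> 0"
      using generating_cone_dual_pointed[OF gen gD(1) s] eq gD(2) by force
    with d have d0: "d > 0" by simp
    have "(\<lambda>x. inverse d * g x) \<in> functional_ray f"
    proof (rule fD(3))
      show "(\<lambda>x. inverse d * g x) \<in> dual_wedge K" "(\<lambda>x. inverse d * s x) \<in> dual_wedge K"
        using gD(1) s d by (auto intro!: dual_wedge_scale)
      show "f x = inverse d * g x + inverse d * s x" for x
        using eq[of x] d0 by (simp add: field_simps)
    qed
    then obtain e where e: "e \<ge> 0" "(\<lambda>x. inverse d * g x) = (\<lambda>x. e * f x)"
      by (auto simp: functional_ray_def)
    have "g x = (d * e) * f x" for x
      using fun_cong[OF e(2), of x] d0 by (simp add: field_simps)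
    then have "g \<in> functional_ray f"
      using d e(1) by (auto simp: functional_ray_def intro!: exI[of _ "d * e"])
    from functional_ray_eqI[OF this gD(2)] ne show False by simp
  qed
  with that show thesis by blast
qed

section \<open>Continuity of injective linear maps\<close>

text \<open>
  The domain is finite-dimensional but not of class \<^class>\<open>euclidean_space\<close>, so compactness is used
  in the codomain: a linear left inverse of \<open>T\<close> is bounded below on the unit sphere of the range.
\<close>

lemma linear_injective_bounded_linear:
  fixes T :: "'a::real_normed_vector \<Rightarrow> 'b::euclidean_space"
  assumes T: "linear T" and inj: "inj T"
  shows "bounded_linear T"
proof -
  obtain G where G: "linear G" "G \<circ> T = id"
    using linear_injective_left_inverse[OF T inj] by auto
  have GT: "G (T x) = x" for x using G(2) by (metis comp_apply id_apply)
  have sub: "subspace (range T)" using T by (simp add: linear_subspace_image)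
  let ?S = "sphere 0 1 \<inter> range T"
  have comp: "compact ?S"
    using sub by (intro compact_Int_closed closed_subspace) auto
  have cont: "continuous_on ?S (\<lambda>v. norm (G v))"
    using G(1) by (intro continuous_on_norm linear_continuous_on) (simp add: linear_conv_bounded_linear)
  have "\<exists>m>0. \<forall>v\<in>?S. m \<le> norm (G v)"
  proof (cases "?S = {}")
    case True
    then show ?thesis by (intro exI[of _ 1]) auto
  next
    case False
    obtain u where u: "u \<in> ?S" "\<forall>v\<in>?S. norm (G u) \<le> norm (G v)"
      using continuous_attains_inf[OF comp False cont] by blast
    then obtain x where "u = T x" "norm u = 1" by auto
    then have "G u \<noteq> 0" using GT T by (auto simp: linear_0)
    with u show ?thesis by (intro exI[of _ "norm (G u)"]) auto
  qed
  then obtain m where m: "m > 0" "\<And>v. v \<in> ?S \<Longrightarrow> m \<le> norm (G v)" by auto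
  have "norm (T x) \<le> norm x * (1 / m)" for x
  proof (cases "T x = 0")
    case True
    then show ?thesis using m by simp
  next
    case False
    \<comment> \<open>\<open>G\<close> sends this unit vector to \<open>x\<close> divided by
      \<open>norm (T x)\<close>, so the lower bound \<open>m\<close> on the sphere becomes an upper
      bound for \<open>T\<close>.\<close>
    have "(1 / norm (T x)) *\<^sub>R T x \<in> ?S"
      using False sub by (auto intro!: subspace_scale)
    from m(2)[OF this] have "m \<le> norm x / norm (T x)"
      using G(1) by (simp add: linear_cmul GT)
    then show ?thesis using False m(1) by (simp add: field_simps)
  qed
  with T show ?thesis
    by (intro bounded_linear_intro[of _ "1 / m"]) (auto simp: linear_add linear_cmul)
qed

theorem mainTheorem4:
  fixes K :: "'a::real_normed_vector set"
    and \<phi> :: "'m::finite \<Rightarrow> 'a \<Rightarrow> real"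
  assumes "\<exists>B :: 'a set. finite B \<and> span B = UNIV"
    and "pointed_cone K"
    and "generating_cone K"
    and "polyhedral_cone K"
    and "\<not> simplex_cone K"
    and "bij_betw (\<lambda>i. functional_ray (\<phi> i)) UNIV (extremal_rays (dual_wedge K))"
  shows "bipositive K standard_cone (evaluation_map \<phi>) \<and>
    id_blinfun \<notin> closure (extendable_positive_operators K standard_cone (evaluation_map \<phi>))"
proof -

  \<comment> \<open>Bipositivity and injectivity of the evaluation map\<close>
  let ?T = "evaluation_map \<phi>"
  have ext: "functional_ray (\<phi> i) \<in> extremal_rays (dual_wedge K)" for i
    using assms(6) by (auto simp: bij_betw_def)
  have distinct: "functional_ray (\<phi> j) \<noteq> functional_ray (\<phi> i)" if "i \<noteq> j" for i j
    using assms(6) that by (auto simp: bij_betw_def inj_on_def)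
  have \<phi>: "\<phi> i \<in> dual_wedge K" "\<phi> i \<noteq> (\<lambda>x. 0)" for i
    using extremal_raysD[OF ext] by auto
  have lin\<phi>: "linear (\<phi> i)" for i using \<phi>(1)[of i] by (simp add: dual_wedge_def)
  have \<phi>pos: "\<phi> i x \<ge> 0" if "x \<in> K" for i x using that \<phi>(1)[of i] by (simp add: dual_wedge_def)
  have linT: "linear ?T"
    using lin\<phi> by (intro linearI) (auto simp: evaluation_map_def vec_eq_iff linear_add linear_cmul)
  have in_K: "x \<in> K" if "\<And>i. \<phi> i x \<ge> 0" for x
  proof -
    obtain H where H: "K = (\<Inter>\<phi>\<in>H. {x. \<phi> x \<ge> 0})" "H \<subseteq> dual_wedge K"
      "\<And>h. h \<in> H \<Longrightarrow> functional_ray h \<in> extremal_rays (dual_wedge K)"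
      using polyhedral_cone_extremal_halfspaces[OF assms(3,4)] by blast
    have "h x \<ge> 0" if h: "h \<in> H" for h
    proof -
      obtain i where "functional_ray h = functional_ray (\<phi> i)"
        using H(3)[OF h] assms(6) by (auto simp: bij_betw_def)
      then have "h \<in> functional_ray (\<phi> i)" using functional_ray_self by metis
      then show ?thesis using \<open>\<And>i. \<phi> i x \<ge> 0\<close> by (auto simp: functional_ray_def)
    qed
    then show ?thesis unfolding H(1) by auto
  qed
  have bipos: "bipositive K standard_cone ?T"
    using linT in_K \<phi>pos by (auto simp: bipositive_def standard_cone_def evaluation_map_def)
  have "x = 0" if "?T x = 0" for x
  proof -
    have "\<phi> i x = 0" for i using that by (simp add: evaluation_map_def vec_eq_iff)
    then have "x \<in> K" "- x \<in> K" using in_K lin\<phi> by (auto simp: linear_neg)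
    then have "x \<in> K \<inter> uminus ` K" by force
    also have "\<dots> = {0}" using assms(2) by (simp add: pointed_cone_def)
    finally show ?thesis by simp
  qed
  then have injT: "inj ?T" using linT by (simp add: linear_injective_0)
  \<comment> \<open>Continuity of \<open>?T\<close> later carries the convergence of
    \<open>A k x\<close> to \<open>x\<close> over to each coordinate.\<close>
  have blT: "bounded_linear ?T" using linear_injective_bounded_linear[OF linT injT] .

  \<comment> \<open>Limits of the matrix entries\<close>
  have "id_blinfun \<notin> closure (extendable_positive_operators K standard_cone ?T)"
  proof
    assume "id_blinfun \<in> closure (extendable_positive_operators K standard_cone ?T)"
    then obtain A where A: "\<And>k. A k \<in> extendable_positive_operators K standard_cone ?T"
      and lim: "A \<longlonglongrightarrow> id_blinfun"
      unfolding closure_sequential by auto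
    from A obtain S where S: "\<And>k. positive_operator standard_cone K (S k)"
      "\<And>k. S k \<circ> ?T = blinfun_apply (A k)"
      unfolding extendable_positive_operators_def by simp metis
    \<comment> \<open>These points encode the columns of the matrix of
      \<open>?T \<circ> S k\<close>: its \<open>(j, i)\<close> entry is
      \<open>\<phi> j (y k i)\<close>.\<close>
    define y where "y k i = S k (axis i 1)" for k i
    have yK: "y k i \<in> K" for k i
      using S(1)[of k] unfolding y_def positive_operator_def standard_cone_def
      by (force simp: axis_def)
    have expand: "\<phi> j (blinfun_apply (A k) x) = (\<Sum>i\<in>UNIV. \<phi> i x * \<phi> j (y k i))" for j k x
    proof -
      have linS: "linear (S k)" using S(1) by (simp add: positive_operator_def)
      have "?T x = (\<Sum>i\<in>UNIV. \<phi> i x *\<^sub>R axis i 1)"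
        using basis_expansion[of "?T x"]
        by (simp add: evaluation_map_def scalar_mult_eq_scaleR)
      then have "S k (?T x) = (\<Sum>i\<in>UNIV. \<phi> i x *\<^sub>R y k i)"
        using linS by (simp add: linear_sum linear_cmul y_def)
      moreover have "blinfun_apply (A k) x = S k (?T x)" using S(2)[of k] by (metis comp_apply)
      ultimately show ?thesis using lin\<phi> by (simp add: linear_sum linear_cmul)
    qed
    have conv: "(\<lambda>k. \<Sum>i\<in>UNIV. \<phi> i x * \<phi> j (y k i)) \<longlonglongrightarrow> \<phi> j x" for j x
    proof -
      have "(\<lambda>k. blinfun_apply (A k) x) \<longlonglongrightarrow> x"
        using blinfun.tendsto[OF lim tendsto_const[of x]] by simp
      from tendsto_vec_nth[OF bounded_linear.tendsto[OF blT this], of j] show ?thesis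
        by (simp add: evaluation_map_def expand)
    qed
    have off_diagonal: "(\<lambda>k. \<phi> j (y k i)) \<longlonglongrightarrow> 0" if ij: "i \<noteq> j" for i j
    proof -
      obtain x where x: "x \<in> K" "\<phi> j x = 0" "\<phi> i x > 0"
        using extremal_functionals_separated[OF assms(3,4) ext ext distinct[OF ij]] .
      \<comment> \<open>As \<open>x\<close> and all \<open>y k i\<close> lie in \<open>K\<close>,
        every summand is non-negative, so a single one is squeezed between 0 and a sum tending to
        \<open>\<phi> j x = 0\<close>.\<close>
      have "(\<lambda>k. \<phi> i x * \<phi> j (y k i)) \<longlonglongrightarrow> 0"
      proof (rule tendsto_sandwich[OF _ _ tendsto_const])
        show "(\<lambda>k. \<Sum>i\<in>UNIV. \<phi> i x * \<phi> j (y k i)) \<longlonglongrightarrow> 0" using conv[of x j] x(2) by simp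
        show "\<forall>\<^sub>F k in sequentially. 0 \<le> \<phi> i x * \<phi> j (y k i)"
          using \<phi>pos x(1) yK by simp
        show "\<forall>\<^sub>F k in sequentially. \<phi> i x * \<phi> j (y k i) \<le> (\<Sum>i\<in>UNIV. \<phi> i x * \<phi> j (y k i))"
          using \<phi>pos x(1) yK by (intro always_eventually allI member_le_sum) auto
      qed
      from tendsto_mult_left[OF this, of "inverse (\<phi> i x)"] x(3) show ?thesis
        by (simp add: mult.assoc[symmetric])
    qed
    have diagonal: "(\<lambda>k. \<phi> j (y k j)) \<longlonglongrightarrow> 1" for j
    proof -
      obtain x where x: "\<phi> j x \<noteq> 0" using \<phi>(2) by auto
      \<comment> \<open>Subtracting the off-diagonal terms from \<open>conv\<close> isolates the
        diagonal term, whose limit is then divided by \<open>\<phi> j x\<close>.\<close>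
      have "(\<lambda>k. \<Sum>i\<in>UNIV - {j}. \<phi> i x * \<phi> j (y k i)) \<longlonglongrightarrow> (\<Sum>i\<in>UNIV - {j}. \<phi> i x * 0)"
        by (intro tendsto_intros off_diagonal) auto
      from tendsto_diff[OF conv[of x j] this]
      have "(\<lambda>k. \<phi> j x * \<phi> j (y k j)) \<longlonglongrightarrow> \<phi> j x"
        by (simp add: sum.remove[of UNIV j])
      from tendsto_mult_left[OF this, of "inverse (\<phi> j x)"] x show ?thesis
        by (simp add: mult.assoc[symmetric])
    qed

    \<comment> \<open>The basis that makes the cone a simplex cone\<close>
    have "axis i 1 \<in> range ?T" for i
    proof (rule closed_sequentially)
      show "closed (range ?T)"
        using linT by (intro closed_subspace linear_subspace_image) auto
      show "?T (y k i) \<in> range ?T" for k by simp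
      show "(\<lambda>k. ?T (y k i)) \<longlonglongrightarrow> axis i 1"
        using off_diagonal diagonal
        by (intro vec_tendstoI) (auto simp: evaluation_map_def axis_def)
    qed
    then have "\<forall>i. \<exists>x. ?T x = axis i 1" by (simp add: image_iff eq_commute)
    from choice[OF this] obtain b where b: "\<And>i. ?T (b i) = axis i 1" by blast
    \<comment> \<open>The preimages \<open>b i\<close> of the standard basis vectors are dual to the
      functionals \<open>\<phi> j\<close>; injectivity of \<open>?T\<close> then gives the expansion
      \<open>x_eq\<close>.\<close>
    have \<phi>b: "\<phi> j (b i) = (if i = j then 1 else 0)" for i j
      using arg_cong[OF b[of i], of "\<lambda>v. v $ j"] by (simp add: evaluation_map_def axis_def)
    have x_eq: "x = (\<Sum>i\<in>UNIV. \<phi> i x *\<^sub>R b i)" for x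
    proof (rule injD[OF injT])
      have "\<phi> j x = \<phi> j (\<Sum>i\<in>UNIV. \<phi> i x *\<^sub>R b i)" for j
        using lin\<phi>[of j] by (simp add: linear_sum linear_cmul \<phi>b if_distrib cong: if_cong)
      then show "?T x = ?T (\<Sum>i\<in>UNIV. \<phi> i x *\<^sub>R b i)"
        unfolding evaluation_map_def vec_eq_iff vec_lambda_beta by (rule allI)
    qed
    have "simplex_cone K"
      unfolding simplex_cone_def
    proof (intro exI[of _ "range b"] conjI)
      show "independent (range b)"
        unfolding independent_explicit_module
      proof (intro allI impI)
        fix t u v
        assume t: "finite t" "t \<subseteq> range b" "(\<Sum>v\<in>t. u v *\<^sub>R v) = 0" "v \<in> t"
        then obtain j where j: "v = b j" by auto
        have "0 = \<phi> j (\<Sum>v\<in>t. u v *\<^sub>R v)" using t(3) lin\<phi> by (simp add: linear_0)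
        also have "\<dots> = (\<Sum>w\<in>t. u w * \<phi> j w)" using lin\<phi> by (simp add: linear_sum linear_cmul)
        \<comment> \<open>For \<open>w = b i\<close> with \<open>i \<noteq> j\<close> the value
          \<open>\<phi> j w\<close> is 0, while \<open>\<phi> j v = 1\<close>; so such a
          \<open>w\<close> differs from \<open>v\<close> and contributes nothing.\<close>
        also have "\<dots> = (\<Sum>w\<in>t. if w = v then u v else 0)"
          using t(2) j \<phi>b by (intro sum.cong) (auto split: if_splits)
        also have "\<dots> = u v" using t by simp
        finally show "u v = 0" by simp
      qed
      have "x \<in> span (range b)" for x
        by (subst x_eq[of x]) (intro span_sum span_scale span_base rangeI)
      then show "span (range b) = UNIV" by auto
      note hull = iffD1[OF convex_cone_iff convex_cone_convex_cone_hull[of "range b"]]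
      have "K \<subseteq> convex_cone hull range b"
      proof
        fix x assume x: "x \<in> K"
        \<comment> \<open>On \<open>K\<close> the coefficients in \<open>x_eq\<close> are
          non-negative, so every partial sum stays in the generated wedge.\<close>
        have "(\<Sum>i\<in>I. \<phi> i x *\<^sub>R b i) \<in> convex_cone hull range b" if "finite I" for I
          using that
        proof (induction I rule: finite_induct)
          case empty
          then show ?case using hull by simp
        next
          case (insert i I)
          have "b i \<in> convex_cone hull range b" by (simp add: hull_inc)
          then show ?case using insert hull \<phi>pos[OF x] by simp
        qed
        from this[OF finite] show "x \<in> convex_cone hull range b" by (subst x_eq[of x])
      qed
      \<comment> \<open>Each \<open>b i\<close> has coordinates 0 and 1, so \<open>in_K\<close>
        places it in the wedge \<open>K\<close>.\<close>
      moreover have "convex_cone hull range b \<subseteq> K"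
        using in_K \<phi>b assms(2) by (intro hull_minimal) (auto simp: pointed_cone_def)
      ultimately show "K = convex_cone hull range b" by auto
    qed
    with assms(5) show False by simp
  qed
  with bipos show ?thesis by simp
qed

end
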